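(* Let $c_1,c_2\in\mathbb{C}$ satisfy $2\operatorname{Re} c_1-2|c_2|-1>0$, and let $\varphi(s)=c_1+c_2 2^{-s}$, with associated composition operator $C_\varphi:\mathcal{H}^2\to\mathcal{H}^2$. Then for every integer $N\geq 0$, $$a_{N+1}(C_\varphi)\leq \sqrt{\frac{(2\operatorname{Re} c_1-1)(2\operatorname{Re} c_1)}{(2\operatorname{Re} c_1-1)^2-(2|c_2|)^2}}\left(\frac{2|c_2|}{2\operatorname{Re} c_1-1}\right)^N .$$
   Context: For real $\theta$, $\mathbb{C}_\theta=\{s\in\mathbb{C}:\operatorname{Re} s>\theta\}$. The Hardy-Dirichlet space is $\mathcal{H}^2=\{f(s)=\sum_{n=1}^\infty b_n n^{-s}:\ \Vert f\Vert^2=\sum_{n=1}^\infty|b_n|^2<\infty\}$; it is a Hilbert space of analytic functions on $\mathbb{C}_{1/2}$, with orthonormal basis $(n^{-s})_{n\geq1}$. For an analytic map $\varphi:\mathbb{C}_{1/2}\to\mathbb{C}_{1/2}$, the composition operator is $C_\varphi(f)=f\circ\varphi$; for the symbols considered here it is a bounded operator on $\mathcal{H}^2$. For a bounded operator $T:H\to H$ on a Hilbert space $H$ and $N=1,2,\ldots$, the $N$-th approximation number $a_N(T)$ is the distance, in operator norm, from $T$ to the set of operators on $H$ of rank $<N$. Convention: $0^0=1$. *)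

theory Defs
  imports "HOL-Analysis.Analysis" "HOL-Library.Extended_Nat"
begin

definition half_plane :: "real \<Rightarrow> complex set" where
  "half_plane \<theta> = {s. Re s > \<theta>}"

text \<open>Coefficient sequences are indexed from 0: the entry \<open>b n\<close> is the coefficient of \<open>(n + 1)\<^sup>-\<^sup>s\<close>.\<close>

definition square_summable :: "(nat \<Rightarrow> complex) \<Rightarrow> bool" where
  "square_summable b \<longleftrightarrow> summable (\<lambda>n. (cmod (b n))\<^sup>2)"

text \<open>Functions on the half-plane \<open>Re s > 1/2\<close> are represented as total functions
  that vanish outside of it.\<close>

definition restrict_half :: "(complex \<Rightarrow> complex) \<Rightarrow> complex \<Rightarrow> complex" where
  "restrict_half f s = (if s \<in> half_plane (1/2) then f s else 0)"

definition dirichlet_series :: "(nat \<Rightarrow> complex) \<Rightarrow> complex \<Rightarrow> complex" where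
  "dirichlet_series b s = (\<Sum>n. b n * of_nat (Suc n) powr (- s))"

lemma square_summable_add:
  assumes "square_summable a" "square_summable b"
  shows "square_summable (\<lambda>n. a n + b n)"
proof -
  have "(cmod (a n + b n))\<^sup>2 \<le> 2 * ((cmod (a n))\<^sup>2 + (cmod (b n))\<^sup>2)" for n
  proof -
    have "(cmod (a n + b n))\<^sup>2 \<le> (cmod (a n) + cmod (b n))\<^sup>2"
      by (simp add: norm_triangle_ineq power_mono)
    also have "\<dots> \<le> 2 * ((cmod (a n))\<^sup>2 + (cmod (b n))\<^sup>2)"
      using zero_le_power2[of "cmod (a n) - cmod (b n)"]
      by (simp add: power2_eq_square algebra_simps)
    finally show ?thesis .
  qed
  note le = this
  have S: "summable (\<lambda>n. 2 * ((cmod (a n))\<^sup>2 + (cmod (b n))\<^sup>2))"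
    using assms unfolding square_summable_def by (intro summable_mult summable_add)
  show ?thesis
    unfolding square_summable_def by (rule summable_comparison_test'[OF S]) (use le in simp)
qed

lemma square_summable_scale:
  assumes "square_summable b"
  shows "square_summable (\<lambda>n. c * b n)"
  using assms unfolding square_summable_def
  by (simp add: norm_mult power_mult_distrib summable_mult)

lemma square_summable_zero [simp]: "square_summable (\<lambda>n. 0)"
  by (simp add: square_summable_def)

lemma norm_dirichlet_term: "cmod (of_nat (Suc n) powr (- s)) = real (Suc n) powr (- Re s)"
  by (subst norm_powr_real_powr) auto

lemma dirichlet_abs_summable:
  assumes "square_summable b" "Re s > 1/2"
  shows "summable (\<lambda>n. cmod (b n * of_nat (Suc n) powr (- s)))"
proof -
  have "summable (\<lambda>n. real n powr (- 2 * Re s))"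
    using assms(2) by (subst summable_real_powr_iff) auto
  then have "summable (\<lambda>n. real (Suc n) powr (- 2 * Re s))"
    by (subst summable_Suc_iff)
  then have S: "summable (\<lambda>n. (cmod (b n))\<^sup>2 + real (Suc n) powr (- 2 * Re s))"
    using assms(1) unfolding square_summable_def by (rule summable_add[rotated])
  show ?thesis
  proof (rule summable_comparison_test'[OF S])
    fix n :: nat
    let ?x = "cmod (b n)" and ?y = "real (Suc n) powr (- Re s)"
    have y2: "?y\<^sup>2 = real (Suc n) powr (- 2 * Re s)"
      by (simp add: power2_eq_square flip: powr_add)
    have "?x * ?y \<le> ?x\<^sup>2 + ?y\<^sup>2"
      using zero_le_power2[of "?x - ?y"] zero_le_power2[of ?x] zero_le_power2[of ?y]
      unfolding power2_diff by linarith
    then show "norm (cmod (b n * of_nat (Suc n) powr (- s)))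
        \<le> (cmod (b n))\<^sup>2 + real (Suc n) powr (- 2 * Re s)"
      unfolding y2 norm_mult norm_dirichlet_term by simp
  qed
qed

lemma dirichlet_summable:
  assumes "square_summable b" "Re s > 1/2"
  shows "summable (\<lambda>n. b n * of_nat (Suc n) powr (- s))"
  using dirichlet_abs_summable[OF assms] by (rule summable_norm_cancel)

lemma dirichlet_add:
  assumes "square_summable a" "square_summable b"
  shows "restrict_half (dirichlet_series (\<lambda>n. a n + b n)) s =
    restrict_half (dirichlet_series a) s + restrict_half (dirichlet_series b) s"
  using suminf_add[OF dirichlet_summable[OF assms(1), of s] dirichlet_summable[OF assms(2), of s]]
  by (auto simp: restrict_half_def dirichlet_series_def half_plane_def algebra_simps)

lemma dirichlet_scale:
  assumes "square_summable b"
  shows "restrict_half (dirichlet_series (\<lambda>n. c * b n)) s =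
    c * restrict_half (dirichlet_series b) s"
  using suminf_mult[OF dirichlet_summable[OF assms(1), of s], of c]
  by (auto simp: restrict_half_def dirichlet_series_def half_plane_def algebra_simps)

lemma dirichlet_zero [simp]: "restrict_half (dirichlet_series (\<lambda>n. 0)) = (\<lambda>s. 0)"
  by (auto simp: restrict_half_def dirichlet_series_def)

lemma dirichlet_eq_zero:
  assumes b: "square_summable b"
    and z: "restrict_half (dirichlet_series b) = (\<lambda>s. 0)"
  shows "b = (\<lambda>n. 0)"
proof (rule ccontr)
  assume "b \<noteq> (\<lambda>n. 0)"
  then have ex: "\<exists>m. b m \<noteq> 0" by auto
  define m where "m = (LEAST m. b m \<noteq> 0)"
  have bm: "b m \<noteq> 0" using ex unfolding m_def by (rule LeastI_ex)
  have bl: "b k = 0" if "k < m" for k using not_less_Least that unfolding m_def by blast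
  define t where "t = (\<lambda>k n. b n * of_nat (Suc n) powr (- complex_of_real (real (Suc k))))"
  have t_eq: "t k n = b n / of_nat (Suc n) ^ Suc k" for k n
  proof -
    have "(of_nat (Suc n) :: complex) powr (of_nat (Suc k)) = of_nat (Suc n) ^ Suc k"
      by (rule powr_nat') simp
    then show ?thesis
      unfolding t_def powr_minus of_real_of_nat_eq by (simp only: divide_inverse)
  qed
  have abs_sum: "summable (\<lambda>n. cmod (t k n))" for k
    unfolding t_def by (rule dirichlet_abs_summable[OF b]) simp
  have sum0: "(\<Sum>n. t k n) = 0" for k
  proof -
    have "complex_of_real (real (Suc k)) \<in> half_plane (1/2)"
      by (simp add: half_plane_def)
    then show ?thesis
      using fun_cong[OF z, of "complex_of_real (real (Suc k))"]
      unfolding restrict_half_def dirichlet_series_def t_def by (simp only: if_True)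
  qed
  define K where "K = (\<Sum>n. cmod (t 0 n))"
  define q where "q = real (Suc m) / real (Suc (Suc m))"
  have q: "0 \<le> q" "q < 1" by (auto simp: q_def field_simps)
  have bound: "cmod (b m) \<le> real (Suc m) * K * q ^ k" for k
  proof -
    define u where "u = (\<lambda>n. if n = m then 0 else t k n)"
    have u_sum: "summable (\<lambda>n. cmod (u n))"
      by (rule summable_comparison_test'[OF abs_sum[of k]]) (auto simp: u_def)
    have "(\<lambda>n. if n = m then t k n else 0) sums t k m"
      by (rule sums_single)
    moreover have "u sums (\<Sum>n. u n)"
      using summable_norm_cancel[OF u_sum] by (rule summable_sums)
    ultimately have "(\<lambda>n. (if n = m then t k n else 0) + u n) sums (t k m + (\<Sum>n. u n))"
      by (rule sums_add)
    moreover have "(\<lambda>n. (if n = m then t k n else 0) + u n) = t k"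
      by (auto simp: u_def)
    ultimately have "t k m + (\<Sum>n. u n) = 0"
      using sum0[of k] sums_unique by metis
    then have "cmod (t k m) = cmod (\<Sum>n. u n)"
      by (metis add_eq_0_iff norm_minus_cancel)
    also have "\<dots> \<le> (\<Sum>n. cmod (u n))"
      by (rule summable_norm[OF u_sum])
    also have "\<dots> \<le> (\<Sum>n. cmod (t 0 n) * (1 / real (Suc (Suc m))) ^ k)"
    proof (rule suminf_le[OF _ u_sum summable_mult2[OF abs_sum]])
      fix n
      show "cmod (u n) \<le> cmod (t 0 n) * (1 / real (Suc (Suc m))) ^ k"
      proof (cases "n > m")
        case True
        have "cmod (u n) = cmod (t 0 n) * (1 / real (Suc n)) ^ k"
          using True
          by (simp add: u_def t_eq norm_divide norm_mult norm_power power_divide del: of_nat_Suc)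
        also have "\<dots> \<le> cmod (t 0 n) * (1 / real (Suc (Suc m))) ^ k"
          using True by (intro mult_left_mono power_mono divide_left_mono) auto
        finally show ?thesis .
      next
        case False
        then have "u n = 0" using bl[of n] by (auto simp: u_def t_eq)
        then show ?thesis by simp
      qed
    qed
    also have "\<dots> = K * (1 / real (Suc (Suc m))) ^ k"
      unfolding K_def by (rule suminf_mult2[OF abs_sum, symmetric])
    finally have le: "cmod (t k m) \<le> K * (1 / real (Suc (Suc m))) ^ k" .
    have "cmod (b m) = cmod (t k m) * real (Suc m) ^ Suc k"
      by (simp add: t_eq norm_divide norm_mult norm_power del: of_nat_Suc)
    also have "\<dots> \<le> K * (1 / real (Suc (Suc m))) ^ k * real (Suc m) ^ Suc k"
      by (rule mult_right_mono[OF le]) simp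
    also have "\<dots> = real (Suc m) * K * q ^ k"
      by (simp add: q_def power_divide del: of_nat_Suc)
    finally show ?thesis .
  qed
  have "(\<lambda>k. real (Suc m) * K * q ^ k) \<longlonglongrightarrow> real (Suc m) * K * 0"
    using q by (intro tendsto_mult tendsto_const LIMSEQ_power_zero) auto
  then have "cmod (b m) \<le> real (Suc m) * K * 0"
    using bound by (intro LIMSEQ_le_const) auto
  with bm show False by simp
qed

lemma dirichlet_coeff_unique:
  assumes "square_summable a" "square_summable b"
    and "restrict_half (dirichlet_series a) = restrict_half (dirichlet_series b)"
  shows "a = b"
proof -
  have sb: "square_summable (\<lambda>n. (-1) * b n)"
    by (rule square_summable_scale[OF assms(2)])
  have "square_summable (\<lambda>n. a n + (-1) * b n)"
    by (rule square_summable_add[OF assms(1) sb])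
  moreover have "restrict_half (dirichlet_series (\<lambda>n. a n + (-1) * b n)) = (\<lambda>s. 0)"
    using dirichlet_add[OF assms(1) sb] dirichlet_scale[OF assms(2), of "-1"] assms(3) by auto
  ultimately have "(\<lambda>n. a n + (-1) * b n) = (\<lambda>n. 0)"
    by (rule dirichlet_eq_zero)
  then show ?thesis by (auto simp: fun_eq_iff)
qed

typedef h2 = "{f :: complex \<Rightarrow> complex.
    \<exists>b. square_summable b \<and> f = restrict_half (dirichlet_series b)}"
  morphisms h2_fun Abs_h2
  by (rule exI[of _ "\<lambda>s. 0"], simp, rule exI[of _ "\<lambda>n. 0"], simp)

setup_lifting type_definition_h2

definition h2_coeff :: "h2 \<Rightarrow> nat \<Rightarrow> complex" where
  "h2_coeff f = (THE b. square_summable b \<and> h2_fun f = restrict_half (dirichlet_series b))"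

lemma h2_coeff_unique:
  assumes "square_summable b" "h2_fun f = restrict_half (dirichlet_series b)"
  shows "h2_coeff f = b"
  unfolding h2_coeff_def using assms by (intro the_equality) (auto intro: dirichlet_coeff_unique)

lemma square_summable_h2_coeff: "square_summable (h2_coeff f)"
  and h2_fun_eq: "h2_fun f = restrict_half (dirichlet_series (h2_coeff f))"
  using h2_fun[of f] h2_coeff_unique[of _ f] by auto

lift_definition h2_scale :: "complex \<Rightarrow> h2 \<Rightarrow> h2" is "\<lambda>c f s. c * f s"
proof -
  fix c :: complex and f :: "complex \<Rightarrow> complex"
  assume "\<exists>b. square_summable b \<and> f = restrict_half (dirichlet_series b)"
  then obtain b where b: "square_summable b" "f = restrict_half (dirichlet_series b)" by blast
  have "(\<lambda>s. c * f s) = restrict_half (dirichlet_series (\<lambda>n. c * b n))"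
    using b by (simp add: fun_eq_iff dirichlet_scale)
  then show "\<exists>b. square_summable b \<and> (\<lambda>s. c * f s) = restrict_half (dirichlet_series b)"
    using square_summable_scale[OF b(1)] by blast
qed

instantiation h2 :: ab_group_add
begin

lift_definition zero_h2 :: h2 is "\<lambda>s. 0"
  by (rule exI[of _ "\<lambda>n. 0"], simp)

lift_definition plus_h2 :: "h2 \<Rightarrow> h2 \<Rightarrow> h2" is "\<lambda>f g s. f s + g s"
proof -
  fix f g :: "complex \<Rightarrow> complex"
  assume "\<exists>b. square_summable b \<and> f = restrict_half (dirichlet_series b)"
    and "\<exists>b. square_summable b \<and> g = restrict_half (dirichlet_series b)"
  then obtain a b where a: "square_summable a" "f = restrict_half (dirichlet_series a)"
    and b: "square_summable b" "g = restrict_half (dirichlet_series b)" by blast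
  have "(\<lambda>s. f s + g s) = restrict_half (dirichlet_series (\<lambda>n. a n + b n))"
    using a b by (simp add: fun_eq_iff dirichlet_add)
  then show "\<exists>b. square_summable b \<and> (\<lambda>s. f s + g s) = restrict_half (dirichlet_series b)"
    using square_summable_add[OF a(1) b(1)] by blast
qed

definition uminus_h2 :: "h2 \<Rightarrow> h2" where "- f = h2_scale (- 1) f"

definition minus_h2 :: "h2 \<Rightarrow> h2 \<Rightarrow> h2" where "f - g = f + - (g :: h2)"

instance
proof
  fix f g h :: h2
  show "f + g + h = f + (g + h)" by transfer (simp add: algebra_simps)
  show "f + g = g + f" by transfer (simp add: algebra_simps)
  show "0 + f = f" by transfer simp
  show "- f + f = 0" unfolding uminus_h2_def by transfer simp
  show "f - g = f + - g" by (rule minus_h2_def)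
qed

end

lemma vector_space_h2: "vector_space h2_scale"
  by unfold_locales (transfer, simp add: fun_eq_iff algebra_simps)+

global_interpretation h2: vector_space h2_scale
  by (rule vector_space_h2)

lemma h2_coeff_zero: "h2_coeff 0 = (\<lambda>n. 0)"
  by (rule h2_coeff_unique) (auto simp: zero_h2.rep_eq)

lemma h2_coeff_add: "h2_coeff (f + g) = (\<lambda>n. h2_coeff f n + h2_coeff g n)"
  using h2_fun_eq[of f] h2_fun_eq[of g]
  by (intro h2_coeff_unique square_summable_add square_summable_h2_coeff)
    (auto simp: plus_h2.rep_eq fun_eq_iff dirichlet_add square_summable_h2_coeff)

lemma h2_coeff_scale: "h2_coeff (h2_scale c f) = (\<lambda>n. c * h2_coeff f n)"
  using h2_fun_eq[of f]
  by (intro h2_coeff_unique square_summable_scale square_summable_h2_coeff)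
    (auto simp: h2_scale.rep_eq fun_eq_iff dirichlet_scale square_summable_h2_coeff)

instantiation h2 :: real_normed_vector
begin

definition scaleR_h2 :: "real \<Rightarrow> h2 \<Rightarrow> h2" where "scaleR r f = h2_scale (of_real r) f"

definition norm_h2 :: "h2 \<Rightarrow> real" where "norm f = sqrt (\<Sum>n. (cmod (h2_coeff f n))\<^sup>2)"

definition sgn_h2 :: "h2 \<Rightarrow> h2" where "sgn f = scaleR (inverse (norm f)) (f :: h2)"

definition dist_h2 :: "h2 \<Rightarrow> h2 \<Rightarrow> real" where "dist f g = norm (f - g :: h2)"

definition uniformity_h2 :: "(h2 \<times> h2) filter" where
  "uniformity_h2 = (INF e\<in>{0<..}. principal {(x, y). dist x y < e})"

definition open_h2 :: "h2 set \<Rightarrow> bool" where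
  "open_h2 U = (\<forall>x\<in>U. \<forall>\<^sub>F (x', y) in uniformity. x' = x \<longrightarrow> y \<in> U)"

instance
proof
  fix f g :: h2 and r t :: real and U :: "h2 set"
  have sm: "summable (\<lambda>n. (cmod (h2_coeff h n))\<^sup>2)" for h
    using square_summable_h2_coeff[of h] by (simp add: square_summable_def)
  show "dist f g = norm (f - g)" by (rule dist_h2_def)
  show "sgn f = scaleR (inverse (norm f)) f" by (rule sgn_h2_def)
  show "uniformity = (INF e\<in>{0<..}. principal {(x :: h2, y). dist x y < e})"
    by (rule uniformity_h2_def)
  show "open U \<longleftrightarrow> (\<forall>x\<in>U. \<forall>\<^sub>F (x', y) in uniformity. x' = x \<longrightarrow> y \<in> U)"
    by (rule open_h2_def)
  show "r *\<^sub>R (f + g) = r *\<^sub>R f + r *\<^sub>R g" "(r + t) *\<^sub>R f = r *\<^sub>R f + t *\<^sub>R f"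
    "r *\<^sub>R t *\<^sub>R f = (r * t) *\<^sub>R f" "1 *\<^sub>R f = f"
    by (simp_all add: scaleR_h2_def h2.scale_right_distrib h2.scale_left_distrib)
  show "norm f = 0 \<longleftrightarrow> f = 0"
  proof
    assume "norm f = 0"
    then have "\<And>n. h2_coeff f n = 0"
      using suminf_eq_zero_iff[OF sm[of f]] by (simp add: norm_h2_def)
    then have "h2_coeff f = (\<lambda>n. 0)" by auto
    then have "h2_fun f = h2_fun 0"
      using h2_fun_eq[of f] h2_fun_eq[of 0] h2_coeff_zero by metis
    then show "f = 0" by (simp add: h2_fun_inject)
  qed (simp add: norm_h2_def h2_coeff_zero)
  show "norm (r *\<^sub>R f) = \<bar>r\<bar> * norm f"
  proof -
    have "(\<Sum>n. (cmod (h2_coeff (r *\<^sub>R f) n))\<^sup>2) = (\<Sum>n. r\<^sup>2 * (cmod (h2_coeff f n))\<^sup>2)"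
      by (simp add: scaleR_h2_def h2_coeff_scale norm_mult power_mult_distrib)
    also have "\<dots> = r\<^sup>2 * (\<Sum>n. (cmod (h2_coeff f n))\<^sup>2)"
      by (rule suminf_mult[OF sm])
    finally show ?thesis by (simp add: norm_h2_def real_sqrt_mult)
  qed
  have fin: "L2_set (\<lambda>n. cmod (h2_coeff h n)) {..<N} \<le> norm h" for h :: h2 and N
    unfolding L2_set_def norm_h2_def using sm[of h]
    by (intro real_sqrt_le_mono sum_le_suminf) auto
  have nonneg: "0 \<le> norm h" for h :: h2
    unfolding norm_h2_def using sm[of h] by (intro real_sqrt_ge_zero suminf_nonneg) auto
  have "(\<Sum>n<N. (cmod (h2_coeff (f + g) n))\<^sup>2) \<le> (norm f + norm g)\<^sup>2" for N
  proof -
    have "L2_set (\<lambda>n. cmod (h2_coeff (f + g) n)) {..<N}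
        \<le> L2_set (\<lambda>n. cmod (h2_coeff f n) + cmod (h2_coeff g n)) {..<N}"
      by (rule L2_set_mono) (auto simp: h2_coeff_add norm_triangle_ineq)
    also have "\<dots> \<le> norm f + norm g"
      using L2_set_triangle_ineq[of "\<lambda>n. cmod (h2_coeff f n)" "\<lambda>n. cmod (h2_coeff g n)" "{..<N}"]
        fin[of f N] fin[of g N] by linarith
    finally have "(L2_set (\<lambda>n. cmod (h2_coeff (f + g) n)) {..<N})\<^sup>2 \<le> (norm f + norm g)\<^sup>2"
      by (intro power_mono) (auto simp: L2_set_nonneg)
    then show ?thesis by (simp add: L2_set_def sum_nonneg)
  qed
  then have "(\<Sum>n. (cmod (h2_coeff (f + g) n))\<^sup>2) \<le> (norm f + norm g)\<^sup>2"
    by (intro suminf_le_const[OF sm])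
  then have "norm (f + g) \<le> sqrt ((norm f + norm g)\<^sup>2)"
    unfolding norm_h2_def[of "f + g"] by (rule real_sqrt_le_mono)
  then show "norm (f + g) \<le> norm f + norm g"
    using nonneg[of f] nonneg[of g] by simp
qed

end

text \<open>Bounded operators are elements of the real operator space \<open>h2 \<Rightarrow>\<^sub>L h2\<close>; complex linearity
  is imposed separately. The operator norm is the same over either scalar field.\<close>

definition complex_linear :: "(h2 \<Rightarrow>\<^sub>L h2) \<Rightarrow> bool" where
  "complex_linear T \<longleftrightarrow> Vector_Spaces.linear h2_scale h2_scale (blinfun_apply T)"

text \<open>The guard is needed because \<open>h2.dim\<close> is 0 on infinite-dimensional subspaces.\<close>

definition operator_rank :: "(h2 \<Rightarrow>\<^sub>L h2) \<Rightarrow> enat" where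
  "operator_rank T = (if \<exists>B. finite B \<and> range (blinfun_apply T) \<subseteq> h2.span B
    then enat (h2.dim (range (blinfun_apply T))) else \<infinity>)"

text \<open>Only \<open>N \<ge> 1\<close> is meaningful: for \<open>N = 0\<close> the set is empty and \<open>infdist\<close> is 0.\<close>

definition approximation_number :: "nat \<Rightarrow> (h2 \<Rightarrow>\<^sub>L h2) \<Rightarrow> real" where
  "approximation_number N T = infdist T {R. complex_linear R \<and> operator_rank R < enat N}"

text \<open>This is unspecified unless \<open>f \<circ> \<phi>\<close> is in the Hardy-Dirichlet space for every \<open>f\<close> and
  the induced map is bounded.\<close>

definition composition_operator :: "(complex \<Rightarrow> complex) \<Rightarrow> h2 \<Rightarrow>\<^sub>L h2" where
  "composition_operator \<phi> = Blinfun (\<lambda>f. Abs_h2 (restrict_half (h2_fun f \<circ> \<phi>)))"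

end

theory Submission
  imports Defs "HOL-Probability.Distributions"
begin

text \<open>
  Write \<open>\<sigma> = Re c\<^sub>1\<close> and \<open>r = 2 |c\<^sub>2| / (2 \<sigma> - 1) < 1\<close>. For \<open>f(s) = \<Sum> b\<^sub>n n\<^sup>-\<^sup>s\<close>, the
  exponential series of \<open>n\<^sup>-\<^sup>w\<close> at \<open>w = c\<^sub>2 2\<^sup>-\<^sup>s\<close> and an exchange of sums give
  \<open>f(c\<^sub>1 + c\<^sub>2 2\<^sup>-\<^sup>s) = \<Sum>\<^sub>k L\<^sub>k(f) (2\<^sup>k)\<^sup>-\<^sup>s\<close>, where
  \<open>L\<^sub>k(f) = \<Sum>\<^sub>n b\<^sub>n n^(-c\<^sub>1) (-c\<^sub>2 log n)\<^sup>k / k!\<close> is \<open>c\<^sub>2\<^sup>k\<close> times the \<open>k\<close>-th Taylor coefficient of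
  \<open>f\<close> at \<open>c\<^sub>1\<close> (lemma \<open>dirichlet_series_comp\<close>). Hence \<open>C f\<close> is an orthogonal sum over the basis vectors
  with index a power of two. Keeping only the terms \<open>k < N\<close> gives an operator of rank at most \<open>N\<close>, and
  the square of the norm of the error at \<open>f\<close> is the tail \<open>\<Sum>\<^sub>k\<^sub>\<ge>\<^sub>N |L\<^sub>k(f)|\<^sup>2\<close>.

  Everything thus rests on a good bound for the functionals \<open>L\<^sub>k\<close>. By Cauchy-Schwarz,
  \<open>\<parallel>L\<^sub>k\<parallel>\<^sup>2\<close> is at most \<open>|c\<^sub>2|^(2k) / (k!)\<^sup>2\<close> times the moment
  \<open>\<Sum> n^(-2\<sigma>) (log n)^(2k)\<close>. The summand of this moment is not monotone in \<open>n\<close>, so it is not compared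
  with its own integral; instead, writing \<open>n^(-a)\<close> as the tail mass of an exponential density gives
  \<open>\<Sum> n^(-a) (log n)^m \<le> a m! / (a - 1)^(m+1)\<close> for every \<open>m\<close> at once
  (lemma \<open>sum_powr_ln_power_le\<close>). Together with \<open>(2k)! \<le> 4\<^sup>k (k!)\<^sup>2\<close> this yields
  \<open>\<parallel>L\<^sub>k\<parallel>\<^sup>2 \<le> (2\<sigma> / (2\<sigma> - 1)) r^(2k)\<close>, and summing the geometric tail gives exactly the
  claimed constant.
\<close>

section \<open>Moments of the logarithm against a power\<close>

lemma nn_integral_exp_tail:
  fixes a b :: real
  assumes "a > 0"
  shows "(\<integral>\<^sup>+t. ennreal (a * exp (- a * t)) * indicator {b..} t \<partial>lborel) = ennreal (exp (- a * b))"
proof -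
  have lim: "((\<lambda>t. - exp (- a * t)) \<longlongrightarrow> 0) at_top"
    using assms by real_asymp
  have "(\<integral>\<^sup>+t. ennreal (a * exp (- a * t)) * indicator {b..} t \<partial>lborel) = 0 - - exp (- a * b)"
    by (rule nn_integral_FTC_atLeast[OF _ _ _ lim])
      (use assms in \<open>auto intro!: derivative_eq_intros\<close>)
  then show ?thesis by simp
qed

lemma card_ln_le:
  "real (card {n. n < M \<and> ln (real (Suc n)) \<le> t}) \<le> exp t"
proof -
  have "{n. n < M \<and> ln (real (Suc n)) \<le> t} \<subseteq> {..<nat \<lfloor>exp t\<rfloor>}"
  proof safe
    fix n assume "ln (real (Suc n)) \<le> t"
    then have "real (Suc n) \<le> exp t"
      by (metis exp_le_cancel_iff exp_ln of_nat_0_less_iff zero_less_Suc)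
    then show "n < nat \<lfloor>exp t\<rfloor>" by linarith
  qed
  then have "card {n. n < M \<and> ln (real (Suc n)) \<le> t} \<le> nat \<lfloor>exp t\<rfloor>"
    using card_mono[of "{..<nat \<lfloor>exp t\<rfloor>}"] by simp
  then show ?thesis
    by (meson exp_ge_zero of_nat_floor of_nat_mono order_trans)
qed

text \<open>
  Since \<open>n^(-a)\<close> is the integral of \<open>a exp (- a t)\<close> over \<open>t \<ge> log n\<close>, and \<open>log n \<le> t\<close> there, the
  summand is at most the integral of \<open>a exp (- a t) t^m\<close> over \<open>t \<ge> log n\<close>. Summed over \<open>n\<close> under the
  integral sign, the density at \<open>t\<close> is counted once for each \<open>n \<le> exp t\<close>, so the total is at most
  the integral of \<open>a exp (- (a - 1) t) t^m\<close>, an unnormalised Erlang density.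
\<close>

lemma sum_powr_ln_power_le:
  fixes a :: real
  assumes a: "a > 1"
  shows "(\<Sum>n<M. real (Suc n) powr (- a) * ln (real (Suc n)) ^ m) \<le> a * fact m / (a - 1) ^ Suc m"
proof -
  let ?I = "\<lambda>n t. indicator {ln (real (Suc n))..} t :: ennreal"
  define C where "C = a * fact m / (a - 1) ^ Suc m"
  have C: "C \<ge> 0" using a by (simp add: C_def)
  have single: "ennreal (real (Suc n) powr (- a) * ln (real (Suc n)) ^ m)
      \<le> (\<integral>\<^sup>+t. ennreal (a * exp (- a * t) * t ^ m) * ?I n t \<partial>lborel)" for n
  proof -
    have l: "0 \<le> ln (real (Suc n))" by simp
    have "ennreal (real (Suc n) powr (- a) * ln (real (Suc n)) ^ m)
        = ennreal (ln (real (Suc n)) ^ m) * ennreal (exp (- a * ln (real (Suc n))))"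
      using l by (simp add: powr_def ennreal_mult mult.commute del: of_nat_Suc)
    also have "\<dots> = (\<integral>\<^sup>+t. ennreal (ln (real (Suc n)) ^ m) *
        (ennreal (a * exp (- a * t)) * ?I n t) \<partial>lborel)"
      using a by (subst nn_integral_cmult) (auto simp only: nn_integral_exp_tail, measurable)
    also have "\<dots> \<le> (\<integral>\<^sup>+t. ennreal (a * exp (- a * t) * t ^ m) * ?I n t \<partial>lborel)"
    proof (rule nn_integral_mono)
      fix t :: real
      show "ennreal (ln (real (Suc n)) ^ m) * (ennreal (a * exp (- a * t)) * ?I n t)
          \<le> ennreal (a * exp (- a * t) * t ^ m) * ?I n t"
      proof (cases "ln (real (Suc n)) \<le> t")
        case True
        then have "ln (real (Suc n)) ^ m \<le> t ^ m" using l by (intro power_mono)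
        then have "ln (real (Suc n)) ^ m * (a * exp (- a * t)) \<le> a * exp (- a * t) * t ^ m"
          using a by (simp add: mult.commute mult_left_mono del: of_nat_Suc)
        then show ?thesis
          using True l a
          by (simp flip: ennreal_mult add: ennreal_leI del: of_nat_Suc)
      qed simp
    qed
    finally show ?thesis .
  qed
  have "ennreal (\<Sum>n<M. real (Suc n) powr (- a) * ln (real (Suc n)) ^ m)
      = (\<Sum>n<M. ennreal (real (Suc n) powr (- a) * ln (real (Suc n)) ^ m))"
    by (rule sum_ennreal[symmetric]) simp
  also have "\<dots> \<le> (\<Sum>n<M. \<integral>\<^sup>+t. ennreal (a * exp (- a * t) * t ^ m) * ?I n t \<partial>lborel)"
    by (rule sum_mono[OF single])
  also have "\<dots> = (\<integral>\<^sup>+t. (\<Sum>n<M. ennreal (a * exp (- a * t) * t ^ m) * ?I n t) \<partial>lborel)"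
    by (rule nn_integral_sum[symmetric]) simp
  also have "\<dots> \<le> (\<integral>\<^sup>+t. ennreal C * ennreal (erlang_density m (a - 1) t) \<partial>lborel)"
  proof (rule nn_integral_mono)
    fix t :: real
    let ?w = "a * exp (- a * t) * t ^ m"
    have sum_eq: "(\<Sum>n<M. ennreal ?w * ?I n t) =
        ennreal ?w * of_nat (card {n. n < M \<and> ln (real (Suc n)) \<le> t})"
    proof -
      have "(\<Sum>n<M. ?I n t) = (\<Sum>n | n < M \<and> ln (real (Suc n)) \<le> t. 1)"
        by (rule sum.mono_neutral_cong_right) (auto simp: indicator_def)
      then show ?thesis by (simp flip: sum_distrib_left)
    qed
    show "(\<Sum>n<M. ennreal ?w * ?I n t) \<le> ennreal C * ennreal (erlang_density m (a - 1) t)"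
    proof (cases "t < 0")
      case True
      moreover have "0 \<le> ln (real (Suc n))" for n by simp
      ultimately have "t < ln (real (Suc n))" for n
        by (rule order.strict_trans2)
      then have "?I n t = 0" for n
        by (simp add: not_le del: of_nat_Suc)
      then show ?thesis by simp
    next
      case False
      then have w: "?w \<ge> 0" using a by simp
      have "ennreal ?w * of_nat (card {n. n < M \<and> ln (real (Suc n)) \<le> t})
          = ennreal (?w * real (card {n. n < M \<and> ln (real (Suc n)) \<le> t}))"
        using w by (simp add: ennreal_mult ennreal_of_nat_eq_real_of_nat)
      also have "\<dots> \<le> ennreal (?w * exp t)"
        by (intro ennreal_leI mult_left_mono card_ln_le w)
      also have "?w * exp t = C * erlang_density m (a - 1) t"
      proof -
        have "exp (- a * t) * exp t = exp (- (a - 1) * t)"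
          by (simp add: algebra_simps flip: exp_add)
        then have "?w * exp t = a * t ^ m * exp (- (a - 1) * t)"
          by (simp only: mult.assoc mult.left_commute[of _ "t ^ m"])
        also have "\<dots> = C * erlang_density m (a - 1) t"
          using a False by (simp add: C_def erlang_density_def)
        finally show ?thesis .
      qed
      also have "ennreal \<dots> = ennreal C * ennreal (erlang_density m (a - 1) t)"
        using C a by (intro ennreal_mult) auto
      finally show ?thesis unfolding sum_eq .
    qed
  qed
  also have "\<dots> = ennreal C"
    using nn_integral_erlang_ith_moment[of "a - 1" m 0] a by (simp add: nn_integral_cmult)
  finally show ?thesis using C by (simp add: C_def)
qed

section \<open>Cauchy-Schwarz for series\<close>

text \<open>
  The summability of the products is part of the conclusion because it is what makes the functionals
  \<open>L\<^sub>k\<close> linear.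
\<close>

lemma Cauchy_Schwarz_suminf:
  fixes x :: "nat \<Rightarrow> complex" and y :: "nat \<Rightarrow> complex"
  assumes x: "summable (\<lambda>n. (cmod (x n))\<^sup>2)" and y: "summable (\<lambda>n. (cmod (y n))\<^sup>2)"
  shows "summable (\<lambda>n. cmod (x n * y n))"
    and "(cmod (\<Sum>n. x n * y n))\<^sup>2 \<le> (\<Sum>n. (cmod (x n))\<^sup>2) * (\<Sum>n. (cmod (y n))\<^sup>2)"
proof -
  let ?X = "\<Sum>n. (cmod (x n))\<^sup>2" and ?Y = "\<Sum>n. (cmod (y n))\<^sup>2"
  have part: "(\<Sum>n<M. cmod (x n * y n)) \<le> sqrt (?X * ?Y)" for M
  proof -
    have "(\<Sum>n<M. cmod (x n * y n))\<^sup>2 \<le> (\<Sum>n<M. (cmod (x n))\<^sup>2) * (\<Sum>n<M. (cmod (y n))\<^sup>2)"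
      unfolding norm_mult by (rule Cauchy_Schwarz_ineq_sum)
    also have "\<dots> \<le> ?X * ?Y"
      by (intro mult_mono sum_le_suminf x y sum_nonneg suminf_nonneg) auto
    finally show ?thesis by (rule real_le_rsqrt)
  qed
  show S: "summable (\<lambda>n. cmod (x n * y n))"
    by (rule bounded_imp_summable[where B = "sqrt (?X * ?Y)"])
      (auto intro: part simp only: norm_ge_zero simp flip: lessThan_Suc_atMost)
  have "cmod (\<Sum>n. x n * y n) \<le> (\<Sum>n. cmod (x n * y n))"
    by (rule summable_norm[OF S])
  also have "\<dots> \<le> sqrt (?X * ?Y)"
    by (rule suminf_le_const[OF S part])
  finally have "(cmod (\<Sum>n. x n * y n))\<^sup>2 \<le> (sqrt (?X * ?Y))\<^sup>2"
    by (intro power_mono) auto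
  then show "(cmod (\<Sum>n. x n * y n))\<^sup>2 \<le> ?X * ?Y"
    using x y by (simp add: suminf_nonneg)
qed

section \<open>Elements of the Hardy-Dirichlet space given by their coefficients\<close>

definition h2_of :: "(nat \<Rightarrow> complex) \<Rightarrow> h2" where
  "h2_of b = Abs_h2 (restrict_half (dirichlet_series b))"

lemma h2_fun_h2_of:
  "square_summable b \<Longrightarrow> h2_fun (h2_of b) = restrict_half (dirichlet_series b)"
  unfolding h2_of_def by (rule Abs_h2_inverse) auto

lemma h2_coeff_h2_of: "square_summable b \<Longrightarrow> h2_coeff (h2_of b) = b"
  by (rule h2_coeff_unique) (auto simp: h2_fun_h2_of)

lemma h2_eqI: "h2_coeff f = h2_coeff g \<Longrightarrow> f = g"
  by (metis h2_fun_eq h2_fun_inject)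

lemma norm_h2_square: "(norm f)\<^sup>2 = (\<Sum>n. (cmod (h2_coeff f n))\<^sup>2)"
  using square_summable_h2_coeff[of f]
  by (simp add: norm_h2_def square_summable_def suminf_nonneg)

text \<open>
  Entry \<open>n\<close> of a coefficient sequence belongs to the integer \<open>n + 1\<close>, so the coefficient of
  \<open>(2\<^sup>k)\<^sup>-\<^sup>s\<close> sits at position \<open>2\<^sup>k - 1\<close>. The map \<open>x \<mapsto> dyadic x\<close> is the isometric embedding that
  turns the power series with coefficients \<open>x\<close> in the variable \<open>2\<^sup>-\<^sup>s\<close> into a Dirichlet series.
\<close>

definition dyadic :: "(nat \<Rightarrow> complex) \<Rightarrow> nat \<Rightarrow> complex" where
  "dyadic x n = (if \<exists>k. Suc n = 2 ^ k then x (THE k. Suc n = 2 ^ k) else 0)"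

lemma dyadic_at: "dyadic x (2 ^ k - 1) = x k"
  by (auto simp: dyadic_def)

lemma dyadic_outside: "n \<notin> range (\<lambda>k. 2 ^ k - 1) \<Longrightarrow> dyadic x n = 0"
  unfolding dyadic_def by (metis diff_Suc_1 rangeI)

lemma dyadic_cases:
  obtains k where "n = 2 ^ k - 1" | "\<And>x. dyadic x n = 0"
  using dyadic_outside by blast

lemma strict_mono_dyadic: "strict_mono (\<lambda>k. 2 ^ k - 1 :: nat)"
  by (rule strict_monoI) (simp add: diff_less_mono)

lemma dyadic_add: "dyadic (\<lambda>k. x k + y k) = (\<lambda>n. dyadic x n + dyadic y n)"
  by (auto simp: dyadic_def)

lemma dyadic_scale: "dyadic (\<lambda>k. c * x k) = (\<lambda>n. c * dyadic x n)"
  by (auto simp: dyadic_def)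

lemma summable_dyadic_iff: "square_summable (dyadic x) \<longleftrightarrow> square_summable x"
  using summable_mono_reindex[OF strict_mono_dyadic, of "\<lambda>n. (cmod (dyadic x n))\<^sup>2"]
  by (simp add: square_summable_def dyadic_at[simplified] dyadic_outside)

lemma suminf_dyadic: "(\<Sum>n. (cmod (dyadic x n))\<^sup>2) = (\<Sum>k. (cmod (x k))\<^sup>2)"
  using suminf_mono_reindex[OF strict_mono_dyadic, of "\<lambda>n. (cmod (dyadic x n))\<^sup>2"]
  by (simp add: dyadic_at[simplified] dyadic_outside)

lemma dirichlet_series_dyadic: "dirichlet_series (dyadic x) s = (\<Sum>k. x k * (2 powr (- s)) ^ k)"
proof -
  have pw: "(of_nat (Suc (2 ^ k - 1)) :: complex) powr (- s) = (2 powr (- s)) ^ k" for k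
  proof -
    have "Suc (2 ^ k - 1) = 2 ^ k" by simp
    moreover have "(of_nat (2 ^ k) :: complex) powr (- s) = (2 powr (- s)) ^ k"
    proof (induction k)
      case (Suc k)
      have "(of_nat (2 ^ Suc k) :: complex) powr (- s) = (of_real 2 * of_real (2 ^ k)) powr (- s)"
        by simp
      also have "\<dots> = of_real 2 powr (- s) * of_real (2 ^ k) powr (- s)"
        by (rule powr_times_real) auto
      finally show ?case using Suc by simp
    qed simp
    ultimately show ?thesis by metis
  qed
  have "dirichlet_series (dyadic x) s
      = (\<Sum>k. dyadic x (2 ^ k - 1) * of_nat (Suc (2 ^ k - 1)) powr (- s))"
    unfolding dirichlet_series_def
    by (rule suminf_mono_reindex[OF strict_mono_dyadic, symmetric]) (simp add: dyadic_outside)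
  then show ?thesis by (simp only: dyadic_at pw)
qed

section \<open>Taylor coefficients of a Dirichlet series\<close>

text \<open>
  The condition says that the closed disc of radius \<open>|c\<^sub>2|\<close> about \<open>c\<^sub>1\<close> lies in the half-plane
  \<open>Re s > 1/2\<close>. Below, \<open>ratio\<close> is the quotient of \<open>|c\<^sub>2|\<close> by the distance from \<open>c\<^sub>1\<close> to its boundary.
\<close>

locale affine_symbol =
  fixes c\<^sub>1 c\<^sub>2 :: complex
  assumes half_plane_cond: "2 * Re c\<^sub>1 - 2 * cmod c\<^sub>2 - 1 > 0"
begin

definition \<phi> :: "complex \<Rightarrow> complex" where
  "\<phi> s = c\<^sub>1 + c\<^sub>2 * 2 powr (- s)"

definition ratio :: real where
  "ratio = 2 * cmod c\<^sub>2 / (2 * Re c\<^sub>1 - 1)"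

text \<open>
  The vector that represents the functional \<open>L\<^sub>k\<close>: pairing it with the coefficients of \<open>f\<close> gives
  \<open>c\<^sub>2\<^sup>k f\<^sup>(\<^sup>k\<^sup>)(c\<^sub>1) / k!\<close>.
\<close>

definition weight :: "nat \<Rightarrow> nat \<Rightarrow> complex" where
  "weight k n = of_nat (Suc n) powr (- c\<^sub>1) * (- c\<^sub>2 * of_real (ln (real (Suc n)))) ^ k / fact k"

definition taylor :: "(nat \<Rightarrow> complex) \<Rightarrow> nat \<Rightarrow> complex" where
  "taylor b k = (\<Sum>n. b n * weight k n)"

abbreviation coeff_const :: real where
  "coeff_const \<equiv> 2 * Re c\<^sub>1 / (2 * Re c\<^sub>1 - 1)"

lemma Re_c1: "2 * Re c\<^sub>1 > 1"
  using half_plane_cond norm_ge_zero[of c\<^sub>2] by linarith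

lemma coeff_const_nonneg: "coeff_const \<ge> 0"
  using Re_c1 by simp

lemma ratio_nonneg: "0 \<le> ratio" and ratio_less_1: "ratio < 1"
  using half_plane_cond Re_c1 by (auto simp: ratio_def field_simps)

lemma summable_ratio: "summable (\<lambda>k. (ratio ^ k)\<^sup>2)"
  and suminf_ratio: "(\<Sum>k. (ratio ^ k)\<^sup>2) = 1 / (1 - ratio\<^sup>2)"
proof -
  have "norm (ratio\<^sup>2) < 1"
    using ratio_nonneg ratio_less_1 by (simp add: abs_square_less_1)
  moreover have "(\<lambda>k. (ratio ^ k)\<^sup>2) = (\<lambda>k. (ratio\<^sup>2) ^ k)"
    by (simp flip: power_mult add: mult.commute)
  ultimately show "summable (\<lambda>k. (ratio ^ k)\<^sup>2)" "(\<Sum>k. (ratio ^ k)\<^sup>2) = 1 / (1 - ratio\<^sup>2)"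
    by (auto simp: summable_geometric suminf_geometric)
qed

text \<open>
  With \<open>a = 2 Re c\<^sub>1\<close> and \<open>m = 2 k\<close>, the squares of the entries are the terms of the logarithmic
  moment; the factor \<open>(2k)! / (k!)\<^sup>2\<close> left by its bound is a central binomial coefficient, and
  \<open>4\<^sup>k\<close> is what doubles \<open>|c\<^sub>2|\<close> in the ratio.
\<close>

lemma weight_square_sum:
  shows "square_summable (weight k)"
    and "(\<Sum>n. (cmod (weight k n))\<^sup>2) \<le> coeff_const * (ratio ^ k)\<^sup>2"
proof -
  let ?g = "\<lambda>n. real (Suc n) powr (- (2 * Re c\<^sub>1)) * ln (real (Suc n)) ^ (2 * k)"
  define d where "d = (cmod c\<^sub>2 ^ k / fact k)\<^sup>2"
  have eq: "(cmod (weight k n))\<^sup>2 = d * ?g n" for n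
  proof -
    have "cmod (of_nat (Suc n) powr (- c\<^sub>1)) = real (Suc n) powr (- Re c\<^sub>1)"
      by (rule norm_dirichlet_term)
    moreover have "(real (Suc n) powr (- Re c\<^sub>1))\<^sup>2 = real (Suc n) powr (- (2 * Re c\<^sub>1))"
      by (simp add: power2_eq_square flip: powr_add)
    moreover have "cmod (of_real (ln (real (Suc n)))) = ln (real (Suc n))"
      by (simp only: norm_of_real) simp
    ultimately show ?thesis
      unfolding weight_def d_def norm_mult norm_divide norm_power norm_minus_cancel norm_fact
      by (simp add: power_mult_distrib power_divide flip: power_mult del: of_nat_Suc)
         (simp add: mult.commute)
  qed
  have part: "(\<Sum>n<M. (cmod (weight k n))\<^sup>2) \<le> coeff_const * (ratio ^ k)\<^sup>2" for M
  proof -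
    have fact_le: "(fact (2 * k) :: real) \<le> 4 ^ k * (fact k)\<^sup>2"
    proof -
      have "2 * k choose k \<le> 4 ^ k"
        using binomial_le_pow2[of "2 * k" k] by (simp add: power_mult)
      then have "real (2 * k choose k) \<le> real (4 ^ k)"
        by (rule of_nat_mono)
      then have "real (2 * k choose k) \<le> 4 ^ k"
        by (simp only: of_nat_power of_nat_numeral)
      then have "(fact k)\<^sup>2 * real (2 * k choose k) \<le> (fact k)\<^sup>2 * 4 ^ k"
        by (rule mult_left_mono) simp
      moreover have "(fact k)\<^sup>2 * real (2 * k choose k) = fact (2 * k)"
        using binomial_fact[of k "2 * k", where ?'a = real] by (simp add: power2_eq_square)
      ultimately show ?thesis by (simp only: mult.commute)
    qed
    have "(\<Sum>n<M. (cmod (weight k n))\<^sup>2) = d * (\<Sum>n<M. ?g n)"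
      by (simp only: eq sum_distrib_left)
    also have "\<dots> \<le> d * (2 * Re c\<^sub>1 * fact (2 * k) / (2 * Re c\<^sub>1 - 1) ^ Suc (2 * k))"
      by (intro mult_left_mono sum_powr_ln_power_le Re_c1) (simp add: d_def)
    also have "\<dots> \<le> d * (2 * Re c\<^sub>1 * (4 ^ k * (fact k)\<^sup>2) / (2 * Re c\<^sub>1 - 1) ^ Suc (2 * k))"
      using Re_c1 by (intro mult_left_mono divide_right_mono fact_le) (auto simp: d_def)
    also have "\<dots> = coeff_const * (ratio ^ k)\<^sup>2"
    proof -
      have general: "(c ^ k / h)\<^sup>2 * (q * (4 ^ k * h\<^sup>2) / p ^ Suc (2 * k)) = q / p * ((2 * c / p) ^ k)\<^sup>2"
        if "h > 0" "p > 0" for c h p q :: real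
      proof -
        have "(4::real) ^ k = (2 ^ k)\<^sup>2"
          by (simp add: power2_eq_square flip: power_mult_distrib)
        moreover have "p ^ Suc (2 * k) = p * (p ^ k)\<^sup>2"
          by (simp add: power_even_eq)
        moreover have "((2 * c / p) ^ k)\<^sup>2 = (2 ^ k)\<^sup>2 * (c ^ k)\<^sup>2 / (p ^ k)\<^sup>2"
          by (simp only: power_divide power_mult_distrib)
        ultimately show ?thesis
          using that by (simp add: power_divide)
      qed
      show ?thesis
        unfolding d_def ratio_def using Re_c1 by (intro general) auto
    qed
    finally show ?thesis .
  qed
  show S: "square_summable (weight k)"
    unfolding square_summable_def
    by (rule bounded_imp_summable[where B = "coeff_const * (ratio ^ k)\<^sup>2"])
      (auto intro: part simp only: zero_le_power2 simp flip: lessThan_Suc_atMost)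
  show "(\<Sum>n. (cmod (weight k n))\<^sup>2) \<le> coeff_const * (ratio ^ k)\<^sup>2"
    using S part unfolding square_summable_def by (rule suminf_le_const)
qed

lemma abs_summable_taylor:
  assumes "square_summable b"
  shows "summable (\<lambda>n. cmod (b n * weight k n))"
  using Cauchy_Schwarz_suminf(1)[of b "weight k"] assms weight_square_sum(1)[of k]
  by (simp add: square_summable_def)

lemma summable_taylor:
  assumes "square_summable b"
  shows "summable (\<lambda>n. b n * weight k n)"
  using abs_summable_taylor[OF assms] by (rule summable_norm_cancel)

lemma taylor_add:
  assumes "square_summable a" "square_summable b"
  shows "taylor (\<lambda>n. a n + b n) k = taylor a k + taylor b k"
  using suminf_add[OF summable_taylor[OF assms(1)] summable_taylor[OF assms(2)]]
  by (simp add: taylor_def algebra_simps)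

lemma taylor_scale:
  assumes "square_summable b"
  shows "taylor (\<lambda>n. c * b n) k = c * taylor b k"
  using suminf_mult[OF summable_taylor[OF assms], of c] by (simp add: taylor_def algebra_simps)

lemma taylor_bound:
  "(cmod (taylor (h2_coeff f) k))\<^sup>2 \<le> coeff_const * (norm f)\<^sup>2 * (ratio ^ k)\<^sup>2"
proof -
  have "(cmod (taylor (h2_coeff f) k))\<^sup>2 \<le> (norm f)\<^sup>2 * (\<Sum>n. (cmod (weight k n))\<^sup>2)"
    unfolding taylor_def norm_h2_square
    using Cauchy_Schwarz_suminf(2) square_summable_h2_coeff weight_square_sum(1)
    by (simp add: square_summable_def)
  also have "\<dots> \<le> (norm f)\<^sup>2 * (coeff_const * (ratio ^ k)\<^sup>2)"
    by (intro mult_left_mono weight_square_sum(2)) simp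
  finally show ?thesis by (simp add: mult_ac)
qed

text \<open>
  The double series obtained by expanding each \<open>n^(- c\<^sub>2 w)\<close>, \<open>w = 2\<^sup>-\<^sup>s\<close>, into its exponential series
  converges absolutely: summing the moduli over \<open>k\<close> replaces the exponent \<open>c\<^sub>1 + c\<^sub>2 w\<close> by the real
  number \<open>Re c\<^sub>1 - |c\<^sub>2| |w|\<close>, which still exceeds \<open>1/2\<close>. So the sums may be exchanged.
\<close>

lemma dirichlet_series_comp:
  assumes b: "square_summable b" and s: "Re s > 0"
  shows "dirichlet_series b (\<phi> s) = (\<Sum>k. taylor b k * (2 powr (- s)) ^ k)"
proof -
  define w :: complex where "w = 2 powr (- s)"
  define L where "L = (\<lambda>n. complex_of_real (ln (real (Suc n))))"
  define F where "F = (\<lambda>(n, k). b n * weight k n * w ^ k)"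
  have "cmod w = 2 powr (- Re s)"
    unfolding w_def by (subst norm_powr_real_powr) auto
  then have w: "cmod w \<le> 1" using s by (simp add: powr_le_one_le powr_minus_divide ge_one_powr_ge_zero)
  have pw: "of_nat (Suc n) powr z = exp (z * L n)" for z n
    by (simp add: powr_def L_def Ln_of_nat del: of_nat_Suc)
  have nL: "cmod (L n) = ln (real (Suc n))" for n
    unfolding L_def by (simp only: norm_of_real) simp
  have F_eq: "F (n, k) = (b n * of_nat (Suc n) powr (- c\<^sub>1)) * ((- c\<^sub>2 * L n * w) ^ k /\<^sub>R fact k)" for n k
  proof -
    have eq: "(- c\<^sub>2 * L n * w) ^ k /\<^sub>R fact k = (- c\<^sub>2 * L n) ^ k / fact k * w ^ k"
      by (simp only: power_mult_distrib[of _ w] scaleR_conv_of_real of_real_inverse of_real_fact)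
        (simp only: divide_inverse mult_ac)
    show ?thesis
      unfolding eq unfolding F_def weight_def L_def prod.case
      by (simp only: divide_inverse mult.assoc)
  qed
  have exp_sum: "((\<lambda>k. z ^ k /\<^sub>R fact k) has_sum exp z) UNIV" for z :: complex
    by (rule norm_summable_imp_has_sum[OF summable_norm_exp exp_converges])
  have exp_abs: "((\<lambda>k. norm (z ^ k /\<^sub>R fact k)) has_sum exp (norm z)) UNIV" for z :: complex
  proof -
    have "(\<lambda>k. norm (z ^ k /\<^sub>R fact k)) sums exp (norm z)"
      using exp_converges[of "norm z"] by (simp add: norm_power)
    then show ?thesis by (intro sums_nonneg_imp_has_sum) auto
  qed
  have row: "((\<lambda>k. F (n, k)) has_sum b n * of_nat (Suc n) powr (- \<phi> s)) UNIV" for n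
  proof -
    have eq: "of_nat (Suc n) powr (- c\<^sub>1) * exp (- c\<^sub>2 * L n * w) = of_nat (Suc n) powr (- \<phi> s)"
      unfolding pw by (simp add: \<phi>_def w_def algebra_simps flip: exp_add)
    show ?thesis
      using has_sum_cmult_right[OF exp_sum[of "- c\<^sub>2 * L n * w"],
          of "b n * of_nat (Suc n) powr (- c\<^sub>1)"]
      unfolding F_eq by (simp only: mult.assoc[of "b n"] eq)
  qed
  \<comment> \<open>The real exponent that dominates row \<open>n\<close> of the double series.\<close>
  define t where "t = complex_of_real (Re c\<^sub>1 - cmod c\<^sub>2 * cmod w)"
  have row_abs: "((\<lambda>k. norm (F (n, k))) has_sum cmod (b n * of_nat (Suc n) powr (- t))) UNIV" for n
  proof -
    have "cmod (of_nat (Suc n) powr (- c\<^sub>1)) * exp (cmod (- c\<^sub>2 * L n * w))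
        = cmod (of_nat (Suc n) powr (- t))"
    proof -
      have "cmod (of_nat (Suc n) powr (- c\<^sub>1)) = exp (- Re c\<^sub>1 * ln (real (Suc n)))"
        "cmod (of_nat (Suc n) powr (- t)) = exp (- Re t * ln (real (Suc n)))"
        unfolding norm_dirichlet_term by (simp_all add: powr_def)
      then show ?thesis
        by (simp only: norm_mult norm_minus_cancel nL t_def Re_complex_of_real flip: exp_add)
           (simp add: algebra_simps)
    qed
    then have "cmod (b n) * cmod (of_nat (Suc n) powr (- c\<^sub>1)) * exp (cmod (- c\<^sub>2 * L n * w))
        = cmod (b n * of_nat (Suc n) powr (- t))"
      by (simp only: mult.assoc norm_mult[of "b n"])
    moreover have "(\<lambda>k. norm (F (n, k))) = (\<lambda>k. cmod (b n) * cmod (of_nat (Suc n) powr (- c\<^sub>1)) *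
        norm ((- c\<^sub>2 * L n * w) ^ k /\<^sub>R fact k))"
      by (simp only: F_eq norm_mult)
    ultimately show ?thesis
      using has_sum_cmult_right[OF exp_abs[of "- c\<^sub>2 * L n * w"],
          of "cmod (b n) * cmod (of_nat (Suc n) powr (- c\<^sub>1))"]
      by (simp only:)
  qed
  have "Re t > 1/2"
  proof -
    have "cmod c\<^sub>2 * cmod w \<le> cmod c\<^sub>2 * 1"
      by (intro mult_left_mono w) simp
    then show ?thesis unfolding t_def Re_complex_of_real using half_plane_cond by linarith
  qed
  then have "summable (\<lambda>n. cmod (b n * of_nat (Suc n) powr (- t)))"
    by (rule dirichlet_abs_summable[OF b])
  then have "(\<lambda>n. cmod (b n * of_nat (Suc n) powr (- t))) summable_on UNIV"
    by (intro norm_summable_imp_summable_on) simp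
  then have "(\<lambda>p. norm (F p)) summable_on UNIV \<times> UNIV"
    by (intro summable_on_SigmaI[OF row_abs]) auto
  then have F_sum: "F summable_on UNIV \<times> UNIV"
    by (rule abs_summable_summable)
  have col: "((\<lambda>n. F (n, k)) has_sum taylor b k * w ^ k) UNIV" for k
  proof -
    have "((\<lambda>n. b n * weight k n) has_sum taylor b k) UNIV"
      unfolding taylor_def
      by (rule norm_summable_imp_has_sum[OF abs_summable_taylor[OF b]])
        (rule summable_sums[OF summable_taylor[OF b]])
    then show ?thesis unfolding F_def prod.case by (rule has_sum_cmult_left)
  qed
  obtain S where S: "(F has_sum S) (UNIV \<times> UNIV)"
    using F_sum by (auto simp: summable_on_def)
  have "((\<lambda>n. b n * of_nat (Suc n) powr (- \<phi> s)) has_sum S) UNIV"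
    by (rule has_sum_SigmaD[OF S row])
  then have 1: "dirichlet_series b (\<phi> s) = S"
    unfolding dirichlet_series_def by (rule sums_unique[symmetric, OF has_sum_imp_sums])
  have "((\<lambda>(k, n). F (n, k)) has_sum S) (UNIV \<times> UNIV)"
    using S by (subst has_sum_swap[symmetric]) (simp add: case_prod_unfold)
  then have "((\<lambda>k. taylor b k * w ^ k) has_sum S) UNIV"
    by (rule has_sum_SigmaD) (simp add: col)
  then have "(\<Sum>k. taylor b k * w ^ k) = S"
    by (rule sums_unique[symmetric, OF has_sum_imp_sums])
  with 1 show ?thesis unfolding w_def by simp
qed

section \<open>The composition operator and its truncations\<close>

text \<open>
  Restricting the expansion to a set \<open>K\<close> of exponents treats the composition operator
  (\<open>K = UNIV\<close>), its finite-rank approximation (\<open>K = {..<N}\<close>) and the error (\<open>K = - {..<N}\<close>) uniformly.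
\<close>

definition taylor_on :: "nat set \<Rightarrow> h2 \<Rightarrow> nat \<Rightarrow> complex" where
  "taylor_on K f k = (if k \<in> K then taylor (h2_coeff f) k else 0)"

definition image_on :: "nat set \<Rightarrow> h2 \<Rightarrow> h2" where
  "image_on K f = h2_of (dyadic (taylor_on K f))"

lemma taylor_on_bound:
  "(cmod (taylor_on K f k))\<^sup>2 \<le> coeff_const * (norm f)\<^sup>2 * (if k \<in> K then (ratio ^ k)\<^sup>2 else 0)"
  using taylor_bound[of f k] by (simp add: taylor_on_def)

lemma summable_ratio_on: "summable (\<lambda>k. if k \<in> K then (ratio ^ k)\<^sup>2 else 0)"
  by (rule summable_comparison_test'[OF summable_ratio]) auto

lemma square_summable_taylor_on: "square_summable (taylor_on K f)"
  unfolding square_summable_def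
  by (rule summable_comparison_test'[OF summable_mult[OF summable_ratio_on[of K],
        of "coeff_const * (norm f)\<^sup>2"]])
    (use taylor_on_bound in simp)

lemma h2_coeff_image_on: "h2_coeff (image_on K f) = dyadic (taylor_on K f)"
  unfolding image_on_def
  by (simp add: h2_coeff_h2_of summable_dyadic_iff square_summable_taylor_on)

lemma norm_image_on_le:
  "norm (image_on K f) \<le> sqrt (coeff_const * (\<Sum>k. if k \<in> K then (ratio ^ k)\<^sup>2 else 0)) * norm f"
proof -
  have "(norm (image_on K f))\<^sup>2 = (\<Sum>k. (cmod (taylor_on K f k))\<^sup>2)"
    by (simp add: norm_h2_square h2_coeff_image_on suminf_dyadic)
  also have "\<dots> \<le> (\<Sum>k. coeff_const * (norm f)\<^sup>2 * (if k \<in> K then (ratio ^ k)\<^sup>2 else 0))"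
    using square_summable_taylor_on[of K f]
    by (intro suminf_le taylor_on_bound summable_mult summable_ratio_on)
       (simp add: square_summable_def)
  also have "\<dots> = coeff_const * (norm f)\<^sup>2 * (\<Sum>k. if k \<in> K then (ratio ^ k)\<^sup>2 else 0)"
    by (rule suminf_mult[OF summable_ratio_on])
  finally have "(norm (image_on K f))\<^sup>2
      \<le> coeff_const * (\<Sum>k. if k \<in> K then (ratio ^ k)\<^sup>2 else 0) * (norm f)\<^sup>2"
    by (simp add: mult_ac)
  then have "norm (image_on K f)
      \<le> sqrt (coeff_const * (\<Sum>k. if k \<in> K then (ratio ^ k)\<^sup>2 else 0) * (norm f)\<^sup>2)"
    by (rule real_le_rsqrt)
  then show ?thesis by (simp only: real_sqrt_mult real_sqrt_abs abs_norm_cancel)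
qed

lemma image_on_add: "image_on K (f + g) = image_on K f + image_on K g"
proof -
  have "taylor_on K (f + g) = (\<lambda>k. taylor_on K f k + taylor_on K g k)"
    by (simp add: taylor_on_def fun_eq_iff h2_coeff_add taylor_add square_summable_h2_coeff)
  then show ?thesis
    by (intro h2_eqI) (simp add: h2_coeff_image_on h2_coeff_add dyadic_add)
qed

lemma image_on_scale: "image_on K (h2_scale c f) = h2_scale c (image_on K f)"
proof -
  have "taylor_on K (h2_scale c f) = (\<lambda>k. c * taylor_on K f k)"
    by (simp add: taylor_on_def fun_eq_iff h2_coeff_scale taylor_scale square_summable_h2_coeff)
  then show ?thesis
    by (intro h2_eqI) (simp add: h2_coeff_image_on h2_coeff_scale dyadic_scale)
qed

lemma bounded_linear_image_on: "bounded_linear (image_on K)"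
proof (rule bounded_linear_intro)
  show "norm (image_on K f)
      \<le> norm f * sqrt (coeff_const * (\<Sum>k. if k \<in> K then (ratio ^ k)\<^sup>2 else 0))" for f
    using norm_image_on_le[of K f] by (simp only: mult.commute)
qed (simp_all add: image_on_add scaleR_h2_def image_on_scale)

lemma complex_linear_image_on: "complex_linear (Blinfun (image_on K))"
  unfolding complex_linear_def bounded_linear_Blinfun_apply[OF bounded_linear_image_on]
  by unfold_locales (simp_all add: image_on_add image_on_scale)

text \<open>
  For finite \<open>K\<close> this expresses the image in \<open>card K\<close> fixed basis vectors, which bounds the rank.
\<close>

lemma image_on_eq_sum:
  assumes "finite K"
  shows "image_on K f = (\<Sum>k\<in>K. h2_scale (taylor (h2_coeff f) k) (h2_of (dyadic (\<lambda>j. of_bool (j = k)))))"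
proof (rule h2_eqI)
  have ss: "square_summable (dyadic (\<lambda>j. of_bool (j = k)))" for k
  proof -
    have "summable (\<lambda>j. (cmod (of_bool (j = k)))\<^sup>2)"
      by (rule summable_finite[of "{k}"]) auto
    then show ?thesis
      by (simp only: summable_dyadic_iff) (simp only: square_summable_def)
  qed
  have sum: "h2_coeff (\<Sum>k\<in>K. G k) = (\<lambda>n. \<Sum>k\<in>K. h2_coeff (G k) n)" for G :: "nat \<Rightarrow> h2"
    using assms by (induction K rule: finite_induct) (simp_all add: h2_coeff_zero h2_coeff_add)
  have "dyadic (taylor_on K f) n =
      (\<Sum>k\<in>K. taylor (h2_coeff f) k * dyadic (\<lambda>j. of_bool (j = k)) n)" for n
  proof (cases n rule: dyadic_cases)
    case (1 k)
    then show ?thesis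
      using assms by (simp only: dyadic_at taylor_on_def) (simp add: of_bool_def if_distrib cong: if_cong)
  qed simp
  then show "h2_coeff (image_on K f) = h2_coeff (\<Sum>k\<in>K. h2_scale (taylor (h2_coeff f) k)
      (h2_of (dyadic (\<lambda>j. of_bool (j = k)))))"
    by (simp add: fun_eq_iff h2_coeff_image_on sum h2_coeff_scale h2_coeff_h2_of ss)
qed

lemma operator_rank_image_on:
  assumes "finite K"
  shows "operator_rank (Blinfun (image_on K)) \<le> enat (card K)"
proof -
  let ?B = "(\<lambda>k. h2_of (dyadic (\<lambda>j. of_bool (j = k)))) ` K"
  have fin: "finite ?B" using assms by simp
  have sub: "range (image_on K) \<subseteq> h2.span ?B"
  proof clarify
    fix f
    show "image_on K f \<in> h2.span ?B"
      unfolding image_on_eq_sum[OF assms]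
      by (intro h2.span_sum h2.span_scale h2.span_base imageI)
  qed
  have "h2.dim (range (image_on K)) \<le> card ?B" by (rule h2.dim_le_card[OF sub fin])
  also have "\<dots> \<le> card K" by (rule card_image_le[OF assms])
  finally show ?thesis
    using sub fin unfolding operator_rank_def bounded_linear_Blinfun_apply[OF bounded_linear_image_on]
    by auto
qed

lemma symbol_half_plane:
  assumes "Re s > 0"
  shows "\<phi> s \<in> half_plane (1/2)"
proof -
  have "cmod (2 powr (- s)) = 2 powr (- Re s)"
    by (subst norm_powr_real_powr) auto
  also have "\<dots> \<le> 1" using assms by (simp add: powr_minus_divide ge_one_powr_ge_zero)
  finally have "cmod (c\<^sub>2 * 2 powr (- s)) \<le> cmod c\<^sub>2"
    by (simp add: norm_mult mult_left_le)
  then have "Re (c\<^sub>2 * 2 powr (- s)) \<ge> - cmod c\<^sub>2"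
    using abs_Re_le_cmod[of "c\<^sub>2 * 2 powr (- s)"] by linarith
  then show ?thesis using half_plane_cond by (simp add: \<phi>_def half_plane_def)
qed

lemma composition_eq_image_on: "Abs_h2 (restrict_half (h2_fun f \<circ> \<phi>)) = image_on UNIV f"
proof -
  have "restrict_half (h2_fun f \<circ> \<phi>) s = restrict_half (dirichlet_series (dyadic (taylor_on UNIV f))) s"
    for s
  proof (cases "s \<in> half_plane (1/2)")
    case True
    then have "Re s > 0" by (simp add: half_plane_def)
    then show ?thesis
      using True symbol_half_plane[of s]
      by (simp add: restrict_half_def h2_fun_eq[of f] dirichlet_series_comp square_summable_h2_coeff
          dirichlet_series_dyadic taylor_on_def)
  qed (simp add: restrict_half_def)
  then have "restrict_half (h2_fun f \<circ> \<phi>) = restrict_half (dirichlet_series (dyadic (taylor_on UNIV f)))"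
    by (rule ext)
  then show ?thesis by (simp only: image_on_def h2_of_def)
qed

lemma composition_operator_eq: "composition_operator \<phi> = Blinfun (image_on UNIV)"
  unfolding composition_operator_def composition_eq_image_on ..

lemma image_on_diff: "image_on UNIV f - image_on K f = image_on (- K) f"
proof -
  have "taylor_on UNIV f = (\<lambda>k. taylor_on (- K) f k + taylor_on K f k)"
    by (auto simp: taylor_on_def)
  then have "image_on UNIV f = image_on (- K) f + image_on K f"
    by (intro h2_eqI) (simp add: h2_coeff_image_on h2_coeff_add dyadic_add)
  then show ?thesis by simp
qed

lemma suminf_ratio_tail: "(\<Sum>k. if k \<in> - {..<N} then (ratio ^ k)\<^sup>2 else 0) = (ratio ^ N)\<^sup>2 / (1 - ratio\<^sup>2)"
proof -
  let ?h = "\<lambda>k. if k \<in> - {..<N} then (ratio ^ k)\<^sup>2 else 0"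
  have "(\<Sum>k. ?h k) = (\<Sum>k. ?h (k + N)) + (\<Sum>k<N. ?h k)"
    by (rule suminf_split_initial_segment[OF summable_ratio_on])
  also have "(\<Sum>k. ?h (k + N)) = (\<Sum>k. (ratio ^ N)\<^sup>2 * (ratio ^ k)\<^sup>2)"
    by (simp add: power_add power_mult_distrib mult.commute)
  also have "\<dots> = (ratio ^ N)\<^sup>2 / (1 - ratio\<^sup>2)"
    by (simp add: suminf_mult[OF summable_ratio] suminf_ratio)
  finally show ?thesis by simp
qed

text \<open>
  The competitor in the distance is the truncation to exponents below \<open>N\<close>; the geometric tail of the
  bounds for \<open>L\<^sub>k\<close> controls the norm of the error.
\<close>

lemma approximation_number_le:
  "approximation_number (N + 1) (composition_operator \<phi>) \<le> sqrt (coeff_const / (1 - ratio\<^sup>2)) * ratio ^ N"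
proof -
  let ?R = "Blinfun (image_on {..<N})" and ?C = "Blinfun (image_on UNIV)"
  have "operator_rank ?R \<le> enat N"
    using operator_rank_image_on[of "{..<N}"] by simp
  then have "operator_rank ?R < enat (N + 1)"
    by (rule order.strict_trans1) simp
  then have "approximation_number (N + 1) ?C \<le> dist ?C ?R"
    unfolding approximation_number_def by (intro infdist_le) (simp add: complex_linear_image_on)
  also have "\<dots> = norm (?C - ?R)" by (rule dist_norm)
  also have "\<dots> \<le> sqrt (coeff_const * ((ratio ^ N)\<^sup>2 / (1 - ratio\<^sup>2)))"
  proof (rule norm_blinfun_bound)
    show "0 \<le> sqrt (coeff_const * ((ratio ^ N)\<^sup>2 / (1 - ratio\<^sup>2)))"
      using coeff_const_nonneg ratio_nonneg ratio_less_1
      by (intro real_sqrt_ge_zero mult_nonneg_nonneg divide_nonneg_nonneg)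
        (use Re_c1 in \<open>auto simp: power_le_one\<close>)
    fix f
    show "norm ((?C - ?R) f) \<le> sqrt (coeff_const * ((ratio ^ N)\<^sup>2 / (1 - ratio\<^sup>2))) * norm f"
      using norm_image_on_le[of "- {..<N}" f]
      by (simp only: blinfun.diff_left bounded_linear_Blinfun_apply[OF bounded_linear_image_on]
          image_on_diff suminf_ratio_tail)
  qed
  also have "\<dots> = sqrt (coeff_const / (1 - ratio\<^sup>2)) * ratio ^ N"
    using ratio_nonneg by (simp add: real_sqrt_mult real_sqrt_divide real_sqrt_abs)
  finally show ?thesis unfolding composition_operator_eq .
qed

end

theorem theorem4p1:
  fixes c\<^sub>1 c\<^sub>2 :: complex and N :: nat
  assumes "2 * Re c\<^sub>1 - 2 * cmod c\<^sub>2 - 1 > 0"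
  shows "approximation_number (N + 1) (composition_operator (\<lambda>s. c\<^sub>1 + c\<^sub>2 * 2 powr (- s)))
    \<le> sqrt ((2 * Re c\<^sub>1 - 1) * (2 * Re c\<^sub>1) / ((2 * Re c\<^sub>1 - 1)\<^sup>2 - (2 * cmod c\<^sub>2)\<^sup>2))
      * (2 * cmod c\<^sub>2 / (2 * Re c\<^sub>1 - 1)) ^ N"
proof -
  interpret affine_symbol c\<^sub>1 c\<^sub>2 using assms by unfold_locales
  have symbol: "\<phi> = (\<lambda>s. c\<^sub>1 + c\<^sub>2 * 2 powr (- s))" by (simp add: fun_eq_iff \<phi>_def)
  let ?p = "2 * Re c\<^sub>1 - 1" and ?q = "2 * cmod c\<^sub>2"
  have p: "?p > 0" using Re_c1 by simp
  have "?q\<^sup>2 < ?p\<^sup>2" using assms by (intro power_strict_mono) auto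
  then have "coeff_const / (1 - ratio\<^sup>2) = ?p * (2 * Re c\<^sub>1) / (?p\<^sup>2 - ?q\<^sup>2)"
    using p unfolding ratio_def power_divide by (simp add: divide_simps) (simp add: power2_eq_square)
  then show ?thesis
    using approximation_number_le[of N] unfolding symbol by (simp add: ratio_def)
qed

end
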